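(* Consider one macro time step $[T^N,T^{N+1}]$ of the two-subdomain heterogeneous EMT-TS restricted additive Schwarz (RAS) iteration described in the context, with $\mathbb{A}_{1}$ and $\mathbb{H}_{2}$ invertible, and arbitrary initial iterates $(w_1^{(0)},\mathbb{W}_2^{(0)})$: $$w_1^{(k+1)}=\mathbb{A}_1^{-1}\big(b_1-\mathbb{E}_{1}Z_{1e}^{(k)}\big),\qquad \mathbb{W}_2^{(k+1)}=\mathbb{H}_2^{-1}\big(\mathbb{E}_{2}\,\mathbb{T}[R_{2,e}w_1^{(k)}]+g_2\big),\qquad k\ge 0 .$$ Define the matrix $$P=\begin{pmatrix}0 & P_{ts}\\ P_{emt} & 0\end{pmatrix},\qquad P_{ts}=-\mathbb{A}_1^{-1}\mathbb{E}_{1}\tilde R_{hist}^{0T}(I_m\otimes R_{1,e}),\qquad P_{emt}=\mathbb{H}_2^{-1}\mathbb{E}_{2}\,\mathbb{T}_{lin}R_{2,e}.$$ Then $P$ is the error operator of the method: for every fixed point $(w_1^{(\infty)},\mathbb{W}_2^{(\infty)})$ of the iteration and every $k\ge 0$, $$\begin{pmatrix}w_1^{(k+1)}-w_1^{(\infty)}\\ \mathbb{W}_2^{(k+1)}-\mathbb{W}_2^{(\infty)}\end{pmatrix}=P\begin{pmatrix}w_1^{(k)}-w_1^{(\infty)}\\ \mathbb{W}_2^{(k)}-\mathbb{W}_2^{(\infty)}\end{pmatrix},$$ and the difference between two consecutive iterates satisfies, for every $k\ge 1$, $$\begin{pmatrix}w_1^{(k+1)}-w_1^{(k)}\\ \mathbb{W}_2^{(k+1)}-\mathbb{W}_2^{(k)}\end{pmatrix}=P\begin{pmatrix}w_1^{(k)}-w_1^{(k-1)}\\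 \mathbb{W}_2^{(k)}-\mathbb{W}_2^{(k-1)}\end{pmatrix}.$$
   Context: Setting. A linear DAE (electrical circuit) has unknowns indexed by a finite set $W$, covered by two (possibly overlapping) subsets $W_1,W_2$ with $W_1\cup W_2=W$. $W_{i,e}$ is the set of unknowns outside $W_i$ that are neighbours of $W_i$ in the graph of the system matrix; thus $W_{1,e}\subset W_2$ and $W_{2,e}\subset W_1$. Put $n_i=|W_i|$, $n_{i,e}=|W_{i,e}|$. Subdomain 1 is modelled by dynamic phasors (TS): each unknown is represented by $2K$ real numbers, the real and imaginary parts of $K$ complex harmonic coefficients (harmonics in a set $I$, $|I|=K$). Subdomain 2 is modelled by instantaneous values (EMT). The TS (macro) time step is $\Delta t_{ts}=T^{N+1}-T^N=m\,\Delta t_{emt}$ with $m$ a positive integer; the EMT times are $t^{n+1},\dots,t^{n+m}$ with $t^n=T^N$. $\omega_0$ is the base pulsation, $T_0=2\pi/\omega_0=\tilde m\,\Delta t_{emt}$ the period, with $\tilde m\ge m$ an integer. $j$ is the imaginary unit. Iterates. $w_1^{(k)}\in\mathbb{R}^{2Kn_1}$ is the TS solution at $T^{N+1}$; $\mathbb{W}_2^{(k)}\in\mathbb{R}^{mn_2}$ stacks the EMT solutions at $t^{n+1},\dots,t^{n+m}$. All data from previous macro steps are fixed during the iteration. A fixed point is a pair reproduced by the iteration (the solution of the coupled system). Restrictions. $R_{2,e}\in\mathbb{R}^{2Kn_{2,e}\times 2Kn_1}$ extracts from a TS vector on $W_1$ the coefficients of the unknowns in $W_{2,e}$. $R_{1,e}\in\mathbb{R}^{n_{1,e}\times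 n_2}$ extracts from an EMT vector on $W_2$ the components in $W_{1,e}$; $I_m\otimes R_{1,e}$ does this at each of the $m$ EMT steps. TS side. $\mathbb{A}_1$ is the square matrix of the discretized TS subsystem, of size $2Kn_1$; $b_1$ is a fixed vector (previous-time-step and source terms). $\mathbb{E}_1=\mathbb{E}^{ts}_{1}\mathbb{T}^{emt}_{ts}\in\mathbb{R}^{2Kn_1\times \tilde m n_{1,e}}$, where $\mathbb{E}^{ts}_1\in\mathbb{R}^{2Kn_1\times 2Kn_{1,e}}$ is a fixed coupling matrix and $\mathbb{T}^{emt}_{ts}:\mathbb{R}^{\tilde m n_{1,e}}\to\mathbb{R}^{2Kn_{1,e}}$ is the linear EMT-to-TS translation: for each interface unknown, a discrete Fourier transform of its one-period history keeping the $K$ selected harmonics, multiplication by a fixed phase-compensation factor for each harmonic, then separation into real and imaginary parts. The history $Z_{1e}^{(k)}\in\mathbb{R}^{\tilde m n_{1,e}}$ consists of $\tilde m-m$ blocks of size $n_{1,e}$ that are already-converged values at earlier EMT times (independent of $k$) followed by the $m$ active blocks $(I_m\otimes R_{1,e})\mathbb{W}_2^{(k)}$. $\tilde R_{hist}^{0T}:\mathbb{R}^{mn_{1,e}}\to\mathbb{R}^{\tilde m n_{1,e}}$ places its argument in the last $m$ blocks and fills the first $\tilde m-m$ blocks with zeros. EMT side. $\mathbb{H}_2\in\mathbb{R}^{mn_2\times mn_2}$ is block lower bidiagonal with diagonal blocks $\mathbb{A}_{2}\in\mathbb{R}^{n_2\times n_2}$ and subdiagonal blocks $-\mathbb{I}_{2}$;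 $\mathbb{E}_2\in\mathbb{R}^{mn_2\times mn_{2,e}}$ is block lower bidiagonal with diagonal blocks $E_{2}\in\mathbb{R}^{n_2\times n_{2,e}}$ and subdiagonal blocks $-\mathbb{I}_{2,e}$ (all given matrices); $g_2$ is a fixed vector. The TS-to-EMT translation $\mathbb{T}[\cdot]:\mathbb{R}^{2Kn_{2,e}}\to\mathbb{R}^{mn_{2,e}}$ is the affine map whose block at time $t^l$ ($n+1\le l\le n+m$) is, for $v$ with complex harmonic coefficients $(v_q)_{q\in I}$, $$\mathrm{Re}\sum_{q\in I}\big((1-\theta_l)\,v^N_q+\theta_l\,v_q\big)e^{jq\omega_0t^l},$$ where $(v_q^N)_{q\in I}$ are the fixed (converged) interface coefficients at $T^N$ and $\theta_l\in[0,1]$ is the smoothing weight: for a smoothing length $\alpha\in\{2,\dots,m\}$, $\theta_l=\frac{l-n-1}{\alpha-1}$ if $l\le n+\alpha$ and $\theta_l=1$ otherwise ($\theta_l=1$ for all $l$ if no smoothing). $\mathbb{T}_{lin}$ is its linear part, the real matrix with block at $t^l$ given by $v\mapsto \mathrm{Re}\sum_{q\in I}\theta_l v_qe^{jq\omega_0t^l}$. *)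

theory Defs
  imports Complex_Main
    "Jordan_Normal_Form.Matrix"
    "Jordan_Normal_Form.Gauss_Jordan_Elimination"
begin

text \<open>The inverse of an invertible matrix; unspecified for other arguments.\<close>

definition mat_inv :: "real mat \<Rightarrow> real mat" where
  "mat_inv A = the (mat_inverse A)"

definition kron :: "real mat \<Rightarrow> real mat \<Rightarrow> real mat" where
  "kron A B = mat (dim_row A * dim_row B) (dim_col A * dim_col B)
     (\<lambda>(i, j). A $$ (i div dim_row B, j div dim_col B) * B $$ (i mod dim_row B, j mod dim_col B))"

text \<open>The matrix representing a linear map from column vectors of length \<open>nc\<close> to
  column vectors of length \<open>nr\<close>: its columns are the images of the unit vectors.\<close>

definition matrix_of_map :: "nat \<Rightarrow> nat \<Rightarrow> (real vec \<Rightarrow> real vec) \<Rightarrow> real mat" where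
  "matrix_of_map nr nc f = mat nr nc (\<lambda>(i, j). f (unit_vec nc j) $ i)"

text \<open>\<open>m\<close> by \<open>m\<close> blocks, with \<open>D\<close> on the diagonal and \<open>- S\<close> on the first subdiagonal;
  \<open>S\<close> is meant to have the same dimensions as \<open>D\<close>.\<close>

definition block_lower_bidiag :: "nat \<Rightarrow> real mat \<Rightarrow> real mat \<Rightarrow> real mat" where
  "block_lower_bidiag m D S = mat (m * dim_row D) (m * dim_col D)
     (\<lambda>(i, j). let r = i div dim_row D; c = j div dim_col D;
                   i' = i mod dim_row D; j' = j mod dim_col D
               in if r = c then D $$ (i', j')
                  else if r = Suc c then - (S $$ (i', j'))
                  else 0)"

text \<open>A vector indexed by a finite set of unknowns lists its components in increasing
  order of the unknowns.  The selection matrix maps a vector indexed by \<open>B\<close> to its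
  restriction to the subset \<open>A\<close>.\<close>

definition selection_mat :: "'w::linorder set \<Rightarrow> 'w set \<Rightarrow> real mat" where
  "selection_mat A B = mat (card A) (card B)
     (\<lambda>(i, j). if sorted_list_of_set A ! i = sorted_list_of_set B ! j then 1 else 0)"

text \<open>A vector of \<open>n\<close> dynamic phasors with \<open>K\<close> harmonics has one segment of length
  \<open>2 * K\<close> per unknown, which lists the real and imaginary part of the first harmonic
  coefficient, then of the second one, and so on.  Unknowns and harmonics are given by
  their positions \<open>a < n\<close> and \<open>h < K\<close>.\<close>

definition phasor_coeff :: "nat \<Rightarrow> real vec \<Rightarrow> nat \<Rightarrow> nat \<Rightarrow> complex" where
  "phasor_coeff K v a h = Complex (v $ (2 * K * a + 2 * h)) (v $ (2 * K * a + 2 * h + 1))"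

definition phasor_vec :: "nat \<Rightarrow> nat \<Rightarrow> (nat \<Rightarrow> nat \<Rightarrow> complex) \<Rightarrow> real vec" where
  "phasor_vec K n f = vec (2 * K * n)
     (\<lambda>c. let z = f (c div (2 * K)) (c mod (2 * K) div 2) in if even c then Re z else Im z)"


text \<open>The data of one macro time step.  In \<open>phase_comp\<close> the factor of each harmonic
  is an arbitrary complex number, which also covers the normalization of the discrete
  Fourier transform and the choice of its time origin.  All TS and EMT vectors are
  laid out as above; vectors over several EMT times are stacked time by time.\<close>

record 'w ras =
  unknowns :: "'w set"                    \<comment> \<open>\<open>W\<close>\<close>
  sub1 :: "'w set"                        \<comment> \<open>\<open>W\<^sub>1\<close>, TS\<close>
  sub2 :: "'w set"                        \<comment> \<open>\<open>W\<^sub>2\<close>, EMT\<close>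
  sysmat :: "'w \<Rightarrow> 'w \<Rightarrow> real"            \<comment> \<open>matrix of the whole system\<close>
  harmonics :: "int set"                  \<comment> \<open>\<open>I\<close>\<close>
  puls :: real                            \<comment> \<open>\<open>\<omega>\<^sub>0\<close>\<close>
  dt_emt :: real
  msub :: nat                             \<comment> \<open>\<open>m\<close>, EMT steps per macro step\<close>
  mper :: nat                             \<comment> \<open>\<open>m\<close> tilde, EMT steps per period\<close>
  start_index :: nat                      \<comment> \<open>\<open>n\<close>\<close>
  start_time :: real                      \<comment> \<open>\<open>T\<^sup>N = t\<^sup>n\<close>\<close>
  smoothing :: "nat option"               \<comment> \<open>\<open>\<alpha>\<close>, or no smoothing\<close>
  phase_comp :: "int \<Rightarrow> complex"
  hist :: "real vec"                      \<comment> \<open>converged part of the history\<close>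
  vN :: "real vec"                        \<comment> \<open>interface phasors at \<open>T\<^sup>N\<close>\<close>
  A1 :: "real mat"
  E1ts :: "real mat"
  b1 :: "real vec"
  A2 :: "real mat"
  I2 :: "real mat"
  E2diag :: "real mat"
  I2e :: "real mat"
  g2 :: "real vec"

definition neighbours :: "('w, 'z) ras_scheme \<Rightarrow> 'w set \<Rightarrow> 'w set" where
  "neighbours S X =
     {v \<in> unknowns S - X. \<exists>u\<in>X. sysmat S u v \<noteq> 0 \<or> sysmat S v u \<noteq> 0}"

definition ext1 :: "('w, 'z) ras_scheme \<Rightarrow> 'w set" where
  "ext1 S = neighbours S (sub1 S)"

definition ext2 :: "('w, 'z) ras_scheme \<Rightarrow> 'w set" where
  "ext2 S = neighbours S (sub2 S)"

definition n1 :: "('w, 'z) ras_scheme \<Rightarrow> nat" where "n1 S = card (sub1 S)"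
definition n2 :: "('w, 'z) ras_scheme \<Rightarrow> nat" where "n2 S = card (sub2 S)"
definition n1e :: "('w, 'z) ras_scheme \<Rightarrow> nat" where "n1e S = card (ext1 S)"
definition n2e :: "('w, 'z) ras_scheme \<Rightarrow> nat" where "n2e S = card (ext2 S)"
definition nharm :: "('w, 'z) ras_scheme \<Rightarrow> nat" where "nharm S = card (harmonics S)"

definition harm :: "('w, 'z) ras_scheme \<Rightarrow> nat \<Rightarrow> int" where
  "harm S h = sorted_list_of_set (harmonics S) ! h"

definition ras_setting :: "('w::linorder, 'z) ras_scheme \<Rightarrow> bool" where
  "ras_setting S \<longleftrightarrow>
     finite (unknowns S) \<and> sub1 S \<union> sub2 S = unknowns S \<and> finite (harmonics S) \<and>
     puls S > 0 \<and> dt_emt S > 0 \<and> 2 * pi / puls S = real (mper S) * dt_emt S \<and>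
     1 \<le> msub S \<and> msub S \<le> mper S \<and>
     (\<forall>\<alpha>. smoothing S = Some \<alpha> \<longrightarrow> 2 \<le> \<alpha> \<and> \<alpha> \<le> msub S) \<and>
     hist S \<in> carrier_vec ((mper S - msub S) * n1e S) \<and>
     vN S \<in> carrier_vec (2 * nharm S * n2e S) \<and>
     A1 S \<in> carrier_mat (2 * nharm S * n1 S) (2 * nharm S * n1 S) \<and>
     E1ts S \<in> carrier_mat (2 * nharm S * n1 S) (2 * nharm S * n1e S) \<and>
     b1 S \<in> carrier_vec (2 * nharm S * n1 S) \<and>
     A2 S \<in> carrier_mat (n2 S) (n2 S) \<and>
     I2 S \<in> carrier_mat (n2 S) (n2 S) \<and>
     E2diag S \<in> carrier_mat (n2 S) (n2e S) \<and>
     I2e S \<in> carrier_mat (n2 S) (n2e S) \<and>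
     g2 S \<in> carrier_vec (msub S * n2 S)"

lemma ext_subset:
  assumes "ras_setting S"
  shows "ext1 S \<subseteq> sub2 S" and "ext2 S \<subseteq> sub1 S"
proof -
  have "sub1 S \<union> sub2 S = unknowns S" using assms unfolding ras_setting_def by blast
  then show "ext1 S \<subseteq> sub2 S" and "ext2 S \<subseteq> sub1 S"
    by (auto simp: ext1_def ext2_def neighbours_def)
qed


definition R1e :: "('w::linorder, 'z) ras_scheme \<Rightarrow> real mat" where
  "R1e S = selection_mat (ext1 S) (sub2 S)"

definition R2e :: "('w::linorder, 'z) ras_scheme \<Rightarrow> real mat" where
  "R2e S = kron (selection_mat (ext2 S) (sub1 S)) (1\<^sub>m (2 * nharm S))"

definition R_active :: "('w::linorder, 'z) ras_scheme \<Rightarrow> real mat" where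
  "R_active S = kron (1\<^sub>m (msub S)) (R1e S)"

definition Rhist :: "('w, 'z) ras_scheme \<Rightarrow> real mat" where
  "Rhist S = mat (mper S * n1e S) (msub S * n1e S)
     (\<lambda>(i, j). if i = (mper S - msub S) * n1e S + j then 1 else 0)"

definition Z1e :: "('w::linorder, 'z) ras_scheme \<Rightarrow> real vec \<Rightarrow> real vec" where
  "Z1e S x = hist S @\<^sub>v (R_active S *\<^sub>v x)"

text \<open>The sample at position \<open>s\<close> of the one-period history of the interface unknown at
  position \<open>a\<close> is component \<open>s * n1e S + a\<close> of the stacked history.\<close>

definition emt_to_ts :: "('w, 'z) ras_scheme \<Rightarrow> real vec \<Rightarrow> real vec" where
  "emt_to_ts S z = phasor_vec (nharm S) (n1e S) (\<lambda>a h.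
     phase_comp S (harm S h) *
     (\<Sum>s<mper S. complex_of_real (z $ (s * n1e S + a)) *
        exp (- \<i> * of_real (2 * pi * of_int (harm S h) * real s / real (mper S)))))"

definition T_emt_ts :: "('w, 'z) ras_scheme \<Rightarrow> real mat" where
  "T_emt_ts S = matrix_of_map (2 * nharm S * n1e S) (mper S * n1e S) (emt_to_ts S)"

definition E1 :: "('w, 'z) ras_scheme \<Rightarrow> real mat" where
  "E1 S = E1ts S * T_emt_ts S"

definition H2 :: "('w, 'z) ras_scheme \<Rightarrow> real mat" where
  "H2 S = block_lower_bidiag (msub S) (A2 S) (I2 S)"

definition E2 :: "('w, 'z) ras_scheme \<Rightarrow> real mat" where
  "E2 S = block_lower_bidiag (msub S) (E2diag S) (I2e S)"

definition time :: "('w, 'z) ras_scheme \<Rightarrow> nat \<Rightarrow> real" where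
  "time S l = start_time S + (real l - real (start_index S)) * dt_emt S"

definition theta :: "('w, 'z) ras_scheme \<Rightarrow> nat \<Rightarrow> real" where
  "theta S l = (case smoothing S of
       None \<Rightarrow> 1
     | Some \<alpha> \<Rightarrow> if l \<le> start_index S + \<alpha>
                 then (real l - real (start_index S) - 1) / (real \<alpha> - 1) else 1)"

text \<open>The block at position \<open>i div n2e S\<close> belongs to the time of index
  \<open>l = start_index S + 1 + i div n2e S\<close>.\<close>

definition ts_to_emt :: "('w, 'z) ras_scheme \<Rightarrow> real vec \<Rightarrow> real vec" where
  "ts_to_emt S v = vec (msub S * n2e S) (\<lambda>i.
     let l = start_index S + 1 + i div n2e S; a = i mod n2e S in
     Re (\<Sum>h<nharm S.
       (of_real (1 - theta S l) * phasor_coeff (nharm S) (vN S) a h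
         + of_real (theta S l) * phasor_coeff (nharm S) v a h)
       * exp (\<i> * of_real (of_int (harm S h) * puls S * time S l))))"

definition T_lin :: "('w, 'z) ras_scheme \<Rightarrow> real mat" where
  "T_lin S = matrix_of_map (msub S * n2e S) (2 * nharm S * n2e S) (\<lambda>v.
     vec (msub S * n2e S) (\<lambda>i.
       let l = start_index S + 1 + i div n2e S; a = i mod n2e S in
       Re (\<Sum>h<nharm S.
         of_real (theta S l) * phasor_coeff (nharm S) v a h
         * exp (\<i> * of_real (of_int (harm S h) * puls S * time S l)))))"


definition ts_step :: "('w::linorder, 'z) ras_scheme \<Rightarrow> real vec \<Rightarrow> real vec" where
  "ts_step S x = mat_inv (A1 S) *\<^sub>v (b1 S - E1 S *\<^sub>v Z1e S x)"

definition emt_step :: "('w::linorder, 'z) ras_scheme \<Rightarrow> real vec \<Rightarrow> real vec" where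
  "emt_step S w = mat_inv (H2 S) *\<^sub>v (E2 S *\<^sub>v ts_to_emt S (R2e S *\<^sub>v w) + g2 S)"

definition ras_fixed_point :: "('w::linorder, 'z) ras_scheme \<Rightarrow> real vec \<Rightarrow> real vec \<Rightarrow> bool" where
  "ras_fixed_point S w x \<longleftrightarrow>
     w \<in> carrier_vec (2 * nharm S * n1 S) \<and> x \<in> carrier_vec (msub S * n2 S) \<and>
     w = ts_step S x \<and> x = emt_step S w"

definition P_ts :: "('w::linorder, 'z) ras_scheme \<Rightarrow> real mat" where
  "P_ts S = - (mat_inv (A1 S) * E1 S * Rhist S * R_active S)"

definition P_emt :: "('w::linorder, 'z) ras_scheme \<Rightarrow> real mat" where
  "P_emt S = mat_inv (H2 S) * E2 S * T_lin S * R2e S"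

definition P_ras :: "('w::linorder, 'z) ras_scheme \<Rightarrow> real mat" where
  "P_ras S = four_block_mat
     (0\<^sub>m (2 * nharm S * n1 S) (2 * nharm S * n1 S)) (P_ts S)
     (P_emt S) (0\<^sub>m (msub S * n2 S) (msub S * n2 S))"

end

theory Submission
  imports Defs
begin

text \<open>Both steps are affine in the previous iterate: the history \<open>hist S\<close>, the phasors \<open>vN S\<close>
  and the source terms do not change with \<open>k\<close>, so they cancel in the difference of the images
  of two iterates, and only the linear parts \<open>P_ts S\<close> and \<open>P_emt S\<close> remain.\<close>

section \<open>Inverses and matrices of linear maps\<close>

lemma mat_inv_carrier:
  assumes A: "A \<in> carrier_mat n n" and inv: "invertible_mat A"
  shows "mat_inv A \<in> carrier_mat n n"
proof -
  obtain B where "inverts_mat A B" "inverts_mat B A"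
    using inv by (auto simp: invertible_mat_def)
  then have AB: "A * B = 1\<^sub>m n" and BA: "B * A = 1\<^sub>m (dim_row B)"
    using A by (auto simp: inverts_mat_def)
  \<comment> \<open>\<open>inverts_mat\<close> leaves the shape of \<open>B\<close> open; comparing
    column counts in both products forces it: \<open>A * B\<close> gives the columns of
    \<open>B\<close>, \<open>B * A\<close> its rows.\<close>
  have B: "B \<in> carrier_mat n n"
    using arg_cong[OF AB, of dim_col] arg_cong[OF BA, of dim_col] A by auto
  \<comment> \<open>\<open>mat_inverse\<close> returns \<open>None\<close> only outside the unit
    group of the matrix ring, so membership there makes \<open>the\<close> in \<open>mat_inv\<close>
    well defined.\<close>
  then have "A \<in> Units (ring_mat TYPE(real) n ())"
    using A AB BA by (auto simp: Units_def ring_mat_def)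
  then obtain C where "mat_inverse A = Some C"
    using mat_inverse(1)[OF A, where b = "()"] by (cases "mat_inverse A") auto
  then show ?thesis
    using mat_inverse(2)[OF A] by (simp add: mat_inv_def)
qed

text \<open>The columns are the images of the unit vectors, so expanding \<open>v\<close> in unit
  vectors and using linearity recovers \<open>f v\<close>. This turns \<open>T_lin\<close> back into
  its explicit formula.\<close>

lemma matrix_of_map_mult_vec:
  fixes f :: "real vec \<Rightarrow> real vec"
  assumes v: "v \<in> carrier_vec nc"
    and f: "\<And>u. u \<in> carrier_vec nc \<Longrightarrow> f u \<in> carrier_vec nr"
    and add: "\<And>u u'. u \<in> carrier_vec nc \<Longrightarrow> u' \<in> carrier_vec nc \<Longrightarrow> f (u + u') = f u + f u'"
    and smult: "\<And>c u. u \<in> carrier_vec nc \<Longrightarrow> f (c \<cdot>\<^sub>v u) = c \<cdot>\<^sub>v f u"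
  shows "matrix_of_map nr nc f *\<^sub>v v = f v"
proof (rule eq_vecI)
  fix i assume "i < dim_vec (f v)"
  then have i: "i < nr" using f[OF v] by simp
  \<comment> \<open>Truncations build \<open>v\<close> up one coordinate at a time, so additivity
    for two summands suffices in the induction.\<close>
  define trunc where "trunc k = vec nc (\<lambda>j. if j < k then v $ j else 0)" for k
  have "f (trunc k) $ i = (\<Sum>j<k. v $ j * f (unit_vec nc j) $ i)" if "k \<le> nc" for k
    using that
  proof (induction k)
    case 0
    \<comment> \<open>Writing the zero vector as \<open>0\<close> times \<open>v\<close> lets
      homogeneity yield that \<open>f\<close> vanishes there.\<close>
    have "trunc 0 = 0 \<cdot>\<^sub>v v" using v by (auto simp: trunc_def)
    then show ?case using smult[OF v, of 0] f[OF v] i by simp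
  next
    case (Suc k)
    have "trunc (Suc k) = trunc k + v $ k \<cdot>\<^sub>v unit_vec nc k"
      using Suc.prems by (intro eq_vecI) (auto simp: trunc_def less_Suc_eq)
    moreover have "trunc k \<in> carrier_vec nc" by (simp add: trunc_def)
    ultimately show ?case
      using Suc i f[of "unit_vec nc k"] by (simp add: add smult)
  qed
  from this[of nc] have "f (trunc nc) $ i = (\<Sum>j<nc. v $ j * f (unit_vec nc j) $ i)"
    by simp
  moreover have "trunc nc = v" using v by (auto simp: trunc_def)
  ultimately show "(matrix_of_map nr nc f *\<^sub>v v) $ i = f v $ i"
    using i v by (simp add: matrix_of_map_def scalar_prod_def lessThan_atLeast0 mult.commute)
qed (use f[OF v] in \<open>simp add: matrix_of_map_def\<close>)

lemma mult_mat4_vec: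
  fixes A B C D :: "real mat"
  assumes "A \<in> carrier_mat na nb" "B \<in> carrier_mat nb nc" "C \<in> carrier_mat nc nd"
    "D \<in> carrier_mat nd ne" "v \<in> carrier_vec ne"
  shows "A * B * C * D *\<^sub>v v = A *\<^sub>v (B *\<^sub>v (C *\<^sub>v (D *\<^sub>v v)))"
proof -
  note AB = mult_carrier_mat[OF assms(1,2)]
  note Dv = mult_mat_vec_carrier[OF assms(4,5)]
  note CDv = mult_mat_vec_carrier[OF assms(3) Dv]
  have "A * B * C * D *\<^sub>v v = A * B * C *\<^sub>v (D *\<^sub>v v)"
    by (rule assoc_mult_mat_vec[OF mult_carrier_mat[OF AB assms(3)] assms(4,5)])
  also have "\<dots> = A * B *\<^sub>v (C *\<^sub>v (D *\<^sub>v v))"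
    by (rule assoc_mult_mat_vec[OF AB assms(3) Dv])
  also have "\<dots> = A *\<^sub>v (B *\<^sub>v (C *\<^sub>v (D *\<^sub>v v)))"
    by (rule assoc_mult_mat_vec[OF assms(1,2) CDv])
  finally show ?thesis .
qed

lemma minus_append_vec:
  fixes a b c d :: "'a :: minus vec"
  assumes "a \<in> carrier_vec n" "c \<in> carrier_vec n" "b \<in> carrier_vec m" "d \<in> carrier_vec m"
  shows "(a @\<^sub>v b) - (c @\<^sub>v d) = (a - c) @\<^sub>v (b - d)"
  using assms by (intro eq_vecI) auto

section \<open>Phasor coefficients and the TS-to-EMT translation\<close>

lemma phasor_coeff_linear:
  assumes "u \<in> carrier_vec (2 * K * n)" "v \<in> carrier_vec (2 * K * n)" "a < n" "h < K"
  shows "phasor_coeff K (u + v) a h = phasor_coeff K u a h + phasor_coeff K v a h"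
    and "phasor_coeff K (u - v) a h = phasor_coeff K u a h - phasor_coeff K v a h"
    and "phasor_coeff K (c \<cdot>\<^sub>v u) a h = of_real c * phasor_coeff K u a h"
proof -
  \<comment> \<open>The largest position read, that of the imaginary part, must lie inside the
    vector, since entries of sums and differences are only specified there.\<close>
  have "2 * K * a + 2 * h + 1 < 2 * K * Suc a" using assms(4) by simp
  also have "\<dots> \<le> 2 * K * n" using assms(3) by (intro mult_le_mono2) simp
  finally have "2 * K * a + 2 * h + 1 < 2 * K * n" .
  then show "phasor_coeff K (u + v) a h = phasor_coeff K u a h + phasor_coeff K v a h"
    and "phasor_coeff K (u - v) a h = phasor_coeff K u a h - phasor_coeff K v a h"
    and "phasor_coeff K (c \<cdot>\<^sub>v u) a h = of_real c * phasor_coeff K u a h"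
    using assms(1,2) by (auto simp: phasor_coeff_def complex_eq_iff)
qed

lemma phasor_sum_linear:
  assumes "u \<in> carrier_vec (2 * K * n)" "v \<in> carrier_vec (2 * K * n)" "a < n"
  shows "(\<Sum>h<K. t * phasor_coeff K (u + v) a h * e h)
      = (\<Sum>h<K. t * phasor_coeff K u a h * e h) + (\<Sum>h<K. t * phasor_coeff K v a h * e h)"
    and "(\<Sum>h<K. t * phasor_coeff K (c \<cdot>\<^sub>v u) a h * e h)
      = of_real c * (\<Sum>h<K. t * phasor_coeff K u a h * e h)"
  using phasor_coeff_linear[OF assms]
  by (simp_all add: ring_distribs sum.distrib sum_distrib_left mult_ac)

text \<open>The harmonic sum is complex-linear in the coefficients, and its real part commutes with
  real scalars, so the formula is a real-linear map of \<open>v\<close>.\<close>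

lemma T_lin_mult_vec:
  assumes v: "v \<in> carrier_vec (2 * nharm S * n2e S)"
  shows "T_lin S *\<^sub>v v = vec (msub S * n2e S) (\<lambda>i.
       let l = start_index S + 1 + i div n2e S; a = i mod n2e S in
       Re (\<Sum>h<nharm S.
         of_real (theta S l) * phasor_coeff (nharm S) v a h
         * exp (\<i> * of_real (of_int (harm S h) * puls S * time S l))))"
  unfolding T_lin_def
proof (rule matrix_of_map_mult_vec[OF v], goal_cases)
  case 1
  then show ?case by simp
next
  case (2 u u')
  show ?case
  proof (rule eq_vecI, goal_cases)
    case (1 i)
    \<comment> \<open>With an empty interface there is no index \<open>i\<close>; otherwise the
      remainder is a valid position.\<close>
    then have "i mod n2e S < n2e S" by (cases "n2e S = 0") auto
    then show ?case
      using 1 by (simp add: Let_def phasor_sum_linear(1)[OF 2] del: Re_sum)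
  qed simp
next
  case (3 c u)
  show ?case
  proof (rule eq_vecI, goal_cases)
    case (1 i)
    then have "i mod n2e S < n2e S" by (cases "n2e S = 0") auto
    then show ?case
      using 1 by (simp add: Let_def phasor_sum_linear(2)[OF 3 3] del: Re_sum)
  qed simp
qed

text \<open>The smoothing contribution of \<open>vN S\<close> is the same for both arguments and
  cancels; what survives is weighted by \<open>theta\<close> alone.\<close>

lemma ts_to_emt_diff:
  assumes "u \<in> carrier_vec (2 * nharm S * n2e S)" "v \<in> carrier_vec (2 * nharm S * n2e S)"
  shows "ts_to_emt S u - ts_to_emt S v = T_lin S *\<^sub>v (u - v)"
proof -
  have uv: "u - v \<in> carrier_vec (2 * nharm S * n2e S)" using assms by simp
  show ?thesis unfolding T_lin_mult_vec[OF uv]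
  proof (rule eq_vecI, goal_cases)
    case (1 i)
    then have "i mod n2e S < n2e S" by (cases "n2e S = 0") auto
    then show ?case
      using 1 assms
      by (simp add: Let_def ts_to_emt_def phasor_coeff_linear sum_subtractf[symmetric]
          algebra_simps)
  qed (simp add: ts_to_emt_def)
qed

section \<open>Embedding of the active blocks into the history\<close>

lemma Rhist_mult_vec:
  assumes y: "y \<in> carrier_vec (msub S * n1e S)" and "msub S \<le> mper S"
  shows "Rhist S *\<^sub>v y = 0\<^sub>v ((mper S - msub S) * n1e S) @\<^sub>v y"
proof -
  define d where "d = (mper S - msub S) * n1e S"
  have len: "mper S * n1e S = d + msub S * n1e S"
    unfolding d_def using assms(2) by (simp flip: add_mult_distrib)
  show ?thesis unfolding d_def[symmetric]
  proof (rule eq_vecI, goal_cases)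
    case (1 i)
    then have i: "i < d + msub S * n1e S" using y by simp
    have "(Rhist S *\<^sub>v y) $ i = (\<Sum>j<msub S * n1e S. if i = d + j then y $ j else 0)"
      using i y unfolding Rhist_def len d_def[symmetric]
      by (auto simp: scalar_prod_def lessThan_atLeast0 intro!: sum.cong)
    \<comment> \<open>Solving \<open>i = d + j\<close> for \<open>j\<close> makes the sum collapse
      to one term. The guard \<open>d \<le> i\<close> is essential: for \<open>i < d\<close> natural
      subtraction gives \<open>0\<close> and would wrongly select \<open>j = 0\<close>.\<close>
    also have "\<dots> = (\<Sum>j<msub S * n1e S. if j = i - d then (if d \<le> i then y $ j else 0) else 0)"
      by (intro sum.cong) auto
    also have "\<dots> = (0\<^sub>v d @\<^sub>v y) $ i"
      using i y by auto
    finally show ?case .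
  qed (use y len in \<open>simp add: Rhist_def\<close>)
qed

section \<open>The TS and EMT half steps in a fixed setting\<close>

context
  fixes S :: "('w::linorder, 'z) ras_scheme"
  assumes S: "ras_setting S"
begin

text \<open>The order follows the products: items 1 to 3 are the factors after the inverse in
  \<open>P_ts\<close>, items 5 to 7 those in \<open>P_emt\<close>, ready for
  \<open>mult_mat4_vec\<close>.\<close>

lemma operator_carriers:
  shows "E1 S \<in> carrier_mat (2 * nharm S * n1 S) (mper S * n1e S)"
    and "Rhist S \<in> carrier_mat (mper S * n1e S) (msub S * n1e S)"
    and "R_active S \<in> carrier_mat (msub S * n1e S) (msub S * n2 S)"
    and "H2 S \<in> carrier_mat (msub S * n2 S) (msub S * n2 S)"
    and "E2 S \<in> carrier_mat (msub S * n2 S) (msub S * n2e S)"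
    and "T_lin S \<in> carrier_mat (msub S * n2e S) (2 * nharm S * n2e S)"
    and "R2e S \<in> carrier_mat (2 * nharm S * n2e S) (2 * nharm S * n1 S)"
    and "A1 S \<in> carrier_mat (2 * nharm S * n1 S) (2 * nharm S * n1 S)"
    and "b1 S \<in> carrier_vec (2 * nharm S * n1 S)"
    and "g2 S \<in> carrier_vec (msub S * n2 S)"
  using S
  by (auto simp: ras_setting_def E1_def T_emt_ts_def matrix_of_map_def Rhist_def R_active_def
      R1e_def kron_def selection_mat_def H2_def E2_def block_lower_bidiag_def T_lin_def R2e_def
      n1_def n2_def n1e_def n2e_def intro!: carrier_matI)

text \<open>The converged prefix \<open>hist S\<close> is shared, so its difference is a block of
  zeros, which is exactly what \<open>Rhist\<close> puts before the active blocks.\<close>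

lemma Z1e_diff:
  assumes "x \<in> carrier_vec (msub S * n2 S)" "y \<in> carrier_vec (msub S * n2 S)"
  shows "Z1e S x - Z1e S y = Rhist S *\<^sub>v (R_active S *\<^sub>v (x - y))"
proof -
  note R = operator_carriers(3)
  have h: "hist S \<in> carrier_vec ((mper S - msub S) * n1e S)" and le: "msub S \<le> mper S"
    using S by (auto simp: ras_setting_def)
  have "Z1e S x - Z1e S y
      = (hist S - hist S) @\<^sub>v (R_active S *\<^sub>v x - R_active S *\<^sub>v y)"
    unfolding Z1e_def
    by (rule minus_append_vec[OF h h mult_mat_vec_carrier[OF R assms(1)]
      mult_mat_vec_carrier[OF R assms(2)]])
  also have "\<dots> = 0\<^sub>v ((mper S - msub S) * n1e S) @\<^sub>v (R_active S *\<^sub>v (x - y))"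
    using mult_minus_distrib_mat_vec[OF R assms] minus_cancel_vec[OF h] by simp
  also have "\<dots> = Rhist S *\<^sub>v (R_active S *\<^sub>v (x - y))"
    using Rhist_mult_vec[of _ S] R assms le by simp
  finally show ?thesis .
qed

lemma Z1e_carrier: "Z1e S x \<in> carrier_vec (mper S * n1e S)"
proof -
  have h: "hist S \<in> carrier_vec ((mper S - msub S) * n1e S)" and le: "msub S \<le> mper S"
    using S by (auto simp: ras_setting_def)
  have "dim_vec (Z1e S x) = (mper S - msub S) * n1e S + msub S * n1e S"
    using h operator_carriers(3) by (simp add: Z1e_def)
  also have "\<dots> = mper S * n1e S"
    using le by (simp flip: add_mult_distrib)
  finally show ?thesis by (rule carrier_vecI)
qed

lemma ts_to_emt_carrier: "ts_to_emt S v \<in> carrier_vec (msub S * n2e S)"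
  by (simp add: ts_to_emt_def)

lemma P_ts_carrier:
  assumes "invertible_mat (A1 S)"
  shows "P_ts S \<in> carrier_mat (2 * nharm S * n1 S) (msub S * n2 S)"
  unfolding P_ts_def
  by (intro uminus_carrier_mat mult_carrier_mat)
    (rule mat_inv_carrier[OF operator_carriers(8) assms] operator_carriers)+

lemma P_emt_carrier:
  assumes "invertible_mat (H2 S)"
  shows "P_emt S \<in> carrier_mat (msub S * n2 S) (2 * nharm S * n1 S)"
  unfolding P_emt_def
  by (intro mult_carrier_mat)
    (rule mat_inv_carrier[OF operator_carriers(4) assms] operator_carriers)+

lemma ts_step_carrier:
  assumes "invertible_mat (A1 S)"
  shows "ts_step S x \<in> carrier_vec (2 * nharm S * n1 S)"
  using mat_inv_carrier[OF operator_carriers(8) assms]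
  by (intro carrier_vecI) (auto simp: ts_step_def)

lemma emt_step_carrier:
  assumes "invertible_mat (H2 S)"
  shows "emt_step S w \<in> carrier_vec (msub S * n2 S)"
  using mat_inv_carrier[OF operator_carriers(4) assms]
  by (intro carrier_vecI) (auto simp: emt_step_def)

text \<open>The source \<open>b1 S\<close> cancels. Since the \<open>E1\<close> term is subtracted
  in \<open>ts_step\<close>, its difference enters negated, which is the origin of the sign in
  \<open>P_ts\<close>.\<close>

lemma ts_step_diff:
  assumes inv: "invertible_mat (A1 S)"
    and x: "x \<in> carrier_vec (msub S * n2 S)" and y: "y \<in> carrier_vec (msub S * n2 S)"
  shows "ts_step S x - ts_step S y = P_ts S *\<^sub>v (x - y)"
proof -
  note c = operator_carriers
  define M where "M = mat_inv (A1 S)"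
  have M: "M \<in> carrier_mat (2 * nharm S * n1 S) (2 * nharm S * n1 S)"
    unfolding M_def by (rule mat_inv_carrier[OF c(8) inv])
  have xy: "x - y \<in> carrier_vec (msub S * n2 S)" using x y by simp
  define Zx Zy where "Zx = E1 S *\<^sub>v Z1e S x" and "Zy = E1 S *\<^sub>v Z1e S y"
  have Z: "Zx \<in> carrier_vec (2 * nharm S * n1 S)" "Zy \<in> carrier_vec (2 * nharm S * n1 S)"
    unfolding Zx_def Zy_def using c(1) by (auto intro!: carrier_vecI)
  have "ts_step S x - ts_step S y = M *\<^sub>v ((b1 S - Zx) - (b1 S - Zy))"
    unfolding ts_step_def M_def[symmetric] Zx_def[symmetric] Zy_def[symmetric]
    using M Z c(9) by (subst mult_minus_distrib_mat_vec[OF M]) auto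
  also have "(b1 S - Zx) - (b1 S - Zy) = - (Zx - Zy)"
    using Z c(9) by auto
  also have "M *\<^sub>v - (Zx - Zy) = - (M *\<^sub>v (Zx - Zy))"
    using Z M by (intro eq_vecI) auto
  also have "Zx - Zy = E1 S *\<^sub>v (Rhist S *\<^sub>v (R_active S *\<^sub>v (x - y)))"
    unfolding Zx_def Zy_def Z1e_diff[OF x y, symmetric]
    using mult_minus_distrib_mat_vec[OF c(1) Z1e_carrier Z1e_carrier] by simp
  also have "M *\<^sub>v \<dots> = M * E1 S * Rhist S * R_active S *\<^sub>v (x - y)"
    by (rule mult_mat4_vec[OF M c(1-3) xy, symmetric])
  also have "- \<dots> = P_ts S *\<^sub>v (x - y)"
    unfolding P_ts_def M_def[symmetric]
    by (rule uminus_mult_mat_vec[symmetric]) (use c(3) x y in auto)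
  finally show ?thesis .
qed

text \<open>The source \<open>g2 S\<close> cancels at this level, the affine part of the translation
  in \<open>ts_to_emt_diff\<close>.\<close>

lemma emt_step_diff:
  assumes inv: "invertible_mat (H2 S)"
    and v: "v \<in> carrier_vec (2 * nharm S * n1 S)" and w: "w \<in> carrier_vec (2 * nharm S * n1 S)"
  shows "emt_step S v - emt_step S w = P_emt S *\<^sub>v (v - w)"
proof -
  note c = operator_carriers
  define M where "M = mat_inv (H2 S)"
  have M: "M \<in> carrier_mat (msub S * n2 S) (msub S * n2 S)"
    unfolding M_def by (rule mat_inv_carrier[OF c(4) inv])
  have vw: "v - w \<in> carrier_vec (2 * nharm S * n1 S)" using v w by simp
  define Yv Yw where "Yv = E2 S *\<^sub>v ts_to_emt S (R2e S *\<^sub>v v)"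
    and "Yw = E2 S *\<^sub>v ts_to_emt S (R2e S *\<^sub>v w)"
  have Y: "Yv \<in> carrier_vec (msub S * n2 S)" "Yw \<in> carrier_vec (msub S * n2 S)"
    unfolding Yv_def Yw_def using c(5) by (auto intro!: carrier_vecI)
  have "emt_step S v - emt_step S w = M *\<^sub>v ((Yv + g2 S) - (Yw + g2 S))"
    unfolding emt_step_def M_def[symmetric] Yv_def[symmetric] Yw_def[symmetric]
    using M Y c(10) by (subst mult_minus_distrib_mat_vec[OF M]) auto
  also have "(Yv + g2 S) - (Yw + g2 S) = Yv - Yw"
    using Y c(10) by auto
  also have "\<dots> = E2 S *\<^sub>v (ts_to_emt S (R2e S *\<^sub>v v) - ts_to_emt S (R2e S *\<^sub>v w))"
    unfolding Yv_def Yw_def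
    by (rule mult_minus_distrib_mat_vec[OF c(5) ts_to_emt_carrier ts_to_emt_carrier, symmetric])
  also have "\<dots> = E2 S *\<^sub>v (T_lin S *\<^sub>v (R2e S *\<^sub>v (v - w)))"
    using c(7) v w by (simp add: ts_to_emt_diff mult_minus_distrib_mat_vec[OF c(7)])
  also have "M *\<^sub>v \<dots> = P_emt S *\<^sub>v (v - w)"
    unfolding P_emt_def M_def[symmetric]
    by (rule mult_mat4_vec[OF M c(5-7) vw, symmetric])
  finally show ?thesis .
qed

text \<open>Each half step reads only the previous iterate of the other subdomain, hence the zero
  diagonal blocks. Arbitrary pairs of states are allowed, so one identity serves both fixed points
  and consecutive iterates.\<close>

lemma ras_step_diff:
  assumes invA: "invertible_mat (A1 S)" and invH: "invertible_mat (H2 S)"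
    and v: "v \<in> carrier_vec (2 * nharm S * n1 S)" and w: "w \<in> carrier_vec (2 * nharm S * n1 S)"
    and x: "x \<in> carrier_vec (msub S * n2 S)" and y: "y \<in> carrier_vec (msub S * n2 S)"
  shows "(ts_step S x - ts_step S y) @\<^sub>v (emt_step S v - emt_step S w)
    = P_ras S *\<^sub>v ((v - w) @\<^sub>v (x - y))"
proof -
  note Pt = P_ts_carrier[OF invA] and Pe = P_emt_carrier[OF invH]
  have vw: "v - w \<in> carrier_vec (2 * nharm S * n1 S)" and xy: "x - y \<in> carrier_vec (msub S * n2 S)"
    using v w x y by auto
  have zero: "0\<^sub>m r n *\<^sub>v u = 0\<^sub>v r" if "u \<in> carrier_vec n" for u :: "real vec" and r n
    using that by (intro eq_vecI) auto
  have "P_ras S *\<^sub>v ((v - w) @\<^sub>v (x - y))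
    = (P_ts S *\<^sub>v (x - y)) @\<^sub>v (P_emt S *\<^sub>v (v - w))"
    unfolding P_ras_def
    using four_block_mat_mult_vec[OF zero_carrier_mat Pt Pe zero_carrier_mat vw xy]
      mult_mat_vec_carrier[OF Pt xy] mult_mat_vec_carrier[OF Pe vw]
      zero[OF vw] zero[OF xy]
    by simp
  then show ?thesis
    using ts_step_diff[OF invA x y] emt_step_diff[OF invH v w] by simp
qed

end

theorem proposition1:
  fixes S :: "'w::linorder ras"
    and w1 W2 :: "nat \<Rightarrow> real vec"
  assumes "ras_setting S"
    and "invertible_mat (A1 S)"
    and "invertible_mat (H2 S)"
    and "w1 0 \<in> carrier_vec (2 * nharm S * n1 S)"
    and "W2 0 \<in> carrier_vec (msub S * n2 S)"
    and "\<And>k. w1 (Suc k) = ts_step S (W2 k)"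
    and "\<And>k. W2 (Suc k) = emt_step S (w1 k)"
  shows "(\<forall>winf Winf. ras_fixed_point S winf Winf \<longrightarrow>
           (\<forall>k. (w1 (k + 1) - winf) @\<^sub>v (W2 (k + 1) - Winf)
                = P_ras S *\<^sub>v ((w1 k - winf) @\<^sub>v (W2 k - Winf))))
       \<and> (\<forall>k\<ge>1. (w1 (k + 1) - w1 k) @\<^sub>v (W2 (k + 1) - W2 k)
                = P_ras S *\<^sub>v ((w1 k - w1 (k - 1)) @\<^sub>v (W2 k - W2 (k - 1))))"
proof -
  note diff = ras_step_diff[OF assms(1-3)]
  \<comment> \<open>A case distinction suffices: the initial iterate is given, and every later one
    is the image of a step, whose dimension is known.\<close>
  have W2: "W2 k \<in> carrier_vec (msub S * n2 S)" for k
    using assms(5,7) emt_step_carrier[OF assms(1,3)] by (cases k) auto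
  have w1: "w1 k \<in> carrier_vec (2 * nharm S * n1 S)" for k
    using assms(4,6) ts_step_carrier[OF assms(1,2)] by (cases k) auto
  show ?thesis
  proof (intro conjI allI impI)
    fix winf Winf k
    assume "ras_fixed_point S winf Winf"
    \<comment> \<open>The fixed-point equations are oriented from image to point; in the other
      direction they would rewrite each other forever.\<close>
    then have winf: "winf \<in> carrier_vec (2 * nharm S * n1 S)" "ts_step S Winf = winf"
      and Winf: "Winf \<in> carrier_vec (msub S * n2 S)" "emt_step S winf = Winf"
      unfolding ras_fixed_point_def by metis+
    show "(w1 (k + 1) - winf) @\<^sub>v (W2 (k + 1) - Winf)
        = P_ras S *\<^sub>v ((w1 k - winf) @\<^sub>v (W2 k - Winf))"
      \<comment> \<open>The fixed point is its own image, so the identity compares it directly with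
        iterate \<open>k\<close>.\<close>
      using diff[OF w1[of k] winf(1) W2[of k] Winf(1)] assms(6,7) winf(2) Winf(2) by simp
  next
    fix k :: nat assume "k \<ge> 1"
    \<comment> \<open>With \<open>k = Suc l\<close>, both \<open>k\<close> and \<open>k + 1\<close>
      are successors, so both iterates on the left are images of steps.\<close>
    then obtain l where "k = Suc l" by (cases k) auto
    then show "(w1 (k + 1) - w1 k) @\<^sub>v (W2 (k + 1) - W2 k)
        = P_ras S *\<^sub>v ((w1 k - w1 (k - 1)) @\<^sub>v (W2 k - W2 (k - 1)))"
      using diff[OF w1[of "Suc l"] w1[of l] W2[of "Suc l"] W2[of l]] assms(6,7) by simp
  qed
qed

end
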